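(* Assume that the noise bound $\|y^\delta-y\|_{\mathcal Y}\le\delta$ and the conditional stability estimate (both as described in the context) hold, and that $x^\dagger\in\mathcal D(F)\cap\mathcal X_u$ for some $-a\le s\le u\le 2s+a$. Then for any approximate minimizer $x_\alpha^\delta\in\mathcal X(\alpha;y^\delta)$ with $$\alpha=\delta^{2-2\gamma\frac{u-s}{u+a}}$$ one has $$\|x_\alpha^\delta-x^\dagger\|_{\mathcal X_r}\le C_5\,\delta^{\gamma\frac{u-r}{u+a}}\qquad\text{for all }-a\le r\le s,$$ and $\|F(x_\alpha^\delta)-y^\delta\|_{\mathcal Y}\le C_6\,\delta$, with constants $C_5,C_6$ depending only on the norm $\|x^\dagger\|_{\mathcal X_u}$.
   Context: $\mathcal X,\mathcal Y$ are Hilbert spaces and $F:\mathcal D(F)\subset\mathcal X\to\mathcal Y$ is a nonlinear operator; no properties of $F$ and $\mathcal D(F)$ are required apart from the conditional stability estimate below ($F$ may be non-differentiable or even discontinuous). $\{\mathcal X_t\}_{t\in\mathbb R}$ is the Hilbert scale generated by a densely defined injective self-adjoint linear operator $L:\mathcal D(L)\subset\mathcal X\to\mathcal X$ with compact inverse; the elements of $\mathcal X_t$ have finite norm $\|x\|_{\mathcal X_t}=\|L^tx\|_{\mathcal X}$. Exact data: $y=F(x^\dagger)$ with $x^\dagger\in\mathcal D(F)$ the true solution. Noise bound: the noisy data $y^\delta\in\mathcal Y$ satisfy $\|y^\delta-y\|_{\mathcal Y}\le\delta$. Conditional stability estimate: there exist a function $R:\mathbb R_+\to\mathbb R_+$ and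 real numbers $a\ge0$ and $s,\gamma$ with $-a\le s$ and $0<\gamma\le1$ such that $$\|x_1-x_2\|_{\mathcal X_{-a}}\le R(\rho)\,\|F(x_1)-F(x_2)\|_{\mathcal Y}^\gamma\qquad\text{for all }x_1,x_2\in\mathcal M_\rho^s,$$ where $\mathcal M_\rho^s=\{x\in\mathcal D(F)\cap\mathcal X_s:\ \|x\|_{\mathcal X_s}\le\rho\}$. Tikhonov functional: $T(x;\alpha,y^\delta)=\|F(x)-y^\delta\|_{\mathcal Y}^2+\alpha\|x\|_{\mathcal X_s}^2$. Set of approximate minimizers: $$\mathcal X(\alpha;y^\delta)=\{x\in\mathcal D(F):\ T(x;\alpha,y^\delta)\le\inf_{z\in\mathcal D(F)}T(z;\alpha,y^\delta)+\delta^2\}.$$ *)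

theory Defs
  imports "HOL-Analysis.Analysis"
begin

text \<open>
  An unbounded operator on a real Hilbert space is a total function \<open>L\<close> together with its
  domain \<open>DL\<close>; the values of \<open>L\<close> outside \<open>DL\<close> are irrelevant.  Complex Hilbert
  spaces are covered by restriction of scalars (with the real part of the inner product).
\<close>

definition linear_operator_on :: "'a::real_vector set \<Rightarrow> ('a \<Rightarrow> 'b::real_vector) \<Rightarrow> bool" where
  "linear_operator_on DL L \<longleftrightarrow> subspace DL \<and>
     (\<forall>x\<in>DL. \<forall>y\<in>DL. L (x + y) = L x + L y) \<and> (\<forall>c. \<forall>x\<in>DL. L (c *\<^sub>R x) = c *\<^sub>R L x)"

text \<open>
  The left-hand side of the equivalence says that \<open>y\<close> belongs to the domain of the adjoint and that
  the adjoint maps \<open>y\<close> to \<open>z\<close>; so the graphs of \<open>L\<close> and its adjoint agree.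
\<close>

definition self_adjoint_operator :: "'a::real_inner set \<Rightarrow> ('a \<Rightarrow> 'a) \<Rightarrow> bool" where
  "self_adjoint_operator DL L \<longleftrightarrow>
     (\<forall>y z. (\<forall>x\<in>DL. inner (L x) y = inner x z) \<longleftrightarrow> y \<in> DL \<and> z = L y)"

text \<open>
  The inverse of \<open>L\<close> is taken on the range of \<open>L\<close>.  Surjectivity need not be required: a
  self-adjoint injective operator has dense range, and the range is closed if the inverse is bounded.
\<close>

definition hilbert_scale_generator :: "'a::{real_inner,complete_space} set \<Rightarrow> ('a \<Rightarrow> 'a) \<Rightarrow> bool" where
  "hilbert_scale_generator DL L \<longleftrightarrow>
     linear_operator_on DL L \<and> closure DL = UNIV \<and> inj_on L DL \<and> self_adjoint_operator DL L \<and>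
     compact (closure (inv_into DL L ` (L ` DL \<inter> cball 0 1)))"

definition orth_proj :: "'a::real_inner set \<Rightarrow> 'a \<Rightarrow> 'a" where
  "orth_proj S x = (THE y. y \<in> S \<and> (\<forall>z\<in>S. inner (x - y) z = 0))"

definition eigenspace :: "'a::real_vector set \<Rightarrow> ('a \<Rightarrow> 'a) \<Rightarrow> real \<Rightarrow> 'a set" where
  "eigenspace DL L \<mu> = {x \<in> DL. L x = \<mu> *\<^sub>R x}"

definition eigenvalues :: "'a::real_vector set \<Rightarrow> ('a \<Rightarrow> 'a) \<Rightarrow> real set" where
  "eigenvalues DL L = {\<mu>. \<exists>x\<in>eigenspace DL L \<mu>. x \<noteq> 0}"

text \<open>
  As \<open>L\<close> has a compact inverse, its spectrum consists of eigenvalues, and the functional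
  calculus reads \<open>L\<^sup>t x = (\<Sum>\<mu>. \<mu>\<^sup>t P\<^sub>\<mu> x)\<close>, where \<open>P\<^sub>\<mu>\<close> is the orthogonal
  projection onto the eigenspace of \<open>\<mu>\<close> and the domain of \<open>L\<^sup>t\<close> consists of those
  \<open>x\<close> for which the series converges.  Since \<open>L\<close> is not assumed positive, the powers are those of
  the modulus of \<open>L\<close>; for positive \<open>L\<close> this makes no difference, and in general any
  choice of the branch of \<open>\<mu>\<^sup>t\<close> yields the same norm.
\<close>

definition power_summand ::
    "'a::real_inner set \<Rightarrow> ('a \<Rightarrow> 'a) \<Rightarrow> real \<Rightarrow> 'a \<Rightarrow> real \<Rightarrow> 'a" where
  "power_summand DL L t x \<mu> = (\<bar>\<mu>\<bar> powr t) *\<^sub>R orth_proj (eigenspace DL L \<mu>) x"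

definition op_power :: "'a::real_inner set \<Rightarrow> ('a \<Rightarrow> 'a) \<Rightarrow> real \<Rightarrow> 'a \<Rightarrow> 'a" where
  "op_power DL L t x = infsum (power_summand DL L t x) (eigenvalues DL L)"

text \<open>
  For \<open>t < 0\<close> the space of index \<open>t\<close> of the scale is a completion of the ambient space;
  only its elements lying in the ambient space (in that case, all elements of the latter) are
  represented here.
\<close>

definition scale_space :: "'a::real_inner set \<Rightarrow> ('a \<Rightarrow> 'a) \<Rightarrow> real \<Rightarrow> 'a set" where
  "scale_space DL L t = {x. power_summand DL L t x summable_on eigenvalues DL L}"

definition scale_norm :: "'a::real_inner set \<Rightarrow> ('a \<Rightarrow> 'a) \<Rightarrow> real \<Rightarrow> 'a \<Rightarrow> ennreal" where
  "scale_norm DL L t x =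
     (if x \<in> scale_space DL L t then ennreal (norm (op_power DL L t x)) else \<infinity>)"

definition source_ball ::
    "'a::real_inner set \<Rightarrow> ('a \<Rightarrow> 'a) \<Rightarrow> 'a set \<Rightarrow> real \<Rightarrow> real \<Rightarrow> 'a set" where
  "source_ball DL L D s \<rho> = {x \<in> D \<inter> scale_space DL L s. scale_norm DL L s x \<le> ennreal \<rho>}"

definition conditional_stability ::
    "'a::real_inner set \<Rightarrow> ('a \<Rightarrow> 'a) \<Rightarrow> 'a set \<Rightarrow> ('a \<Rightarrow> 'b::real_inner) \<Rightarrow>
     (real \<Rightarrow> real) \<Rightarrow> real \<Rightarrow> real \<Rightarrow> real \<Rightarrow> bool" where
  "conditional_stability DL L D F R a s \<gamma> \<longleftrightarrow>
     (\<forall>\<rho>\<ge>0. \<forall>x1\<in>source_ball DL L D s \<rho>. \<forall>x2\<in>source_ball DL L D s \<rho>.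
        scale_norm DL L (- a) (x1 - x2) \<le> ennreal (R \<rho> * norm (F x1 - F x2) powr \<gamma>))"

text \<open>The Tikhonov functional is \<open>\<infinity>\<close> outside the space of index \<open>s\<close> (for \<open>\<alpha> > 0\<close>).\<close>

definition tikhonov ::
    "'a::real_inner set \<Rightarrow> ('a \<Rightarrow> 'a) \<Rightarrow> ('a \<Rightarrow> 'b::real_inner) \<Rightarrow> real \<Rightarrow> real \<Rightarrow> 'b \<Rightarrow> 'a \<Rightarrow> ennreal" where
  "tikhonov DL L F s \<alpha> yd x =
     ennreal ((norm (F x - yd))\<^sup>2) + ennreal \<alpha> * (scale_norm DL L s x)\<^sup>2"

definition approx_minimizers ::
    "'a::real_inner set \<Rightarrow> ('a \<Rightarrow> 'a) \<Rightarrow> 'a set \<Rightarrow> ('a \<Rightarrow> 'b::real_inner) \<Rightarrow> real \<Rightarrow> real \<Rightarrow> real \<Rightarrow> 'b \<Rightarrow> 'a set" where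
  "approx_minimizers DL L D F s \<delta> \<alpha> yd =
     {x \<in> D. tikhonov DL L F s \<alpha> yd x \<le> (INF z\<in>D. tikhonov DL L F s \<alpha> yd z) + ennreal (\<delta>\<^sup>2)}"

end

theory Submission
  imports Defs
begin

text \<open>
  Write \<open>e\<close> for the error.  Comparing the Tikhonov functional at the approximate minimizer and at the
  true solution, and moving the cross term by duality to the spaces of index \<open>u\<close> and \<open>2s - u\<close>, gives
  \<open>residual\<^sup>2 + \<alpha> \<parallel>e\<parallel>\<^sub>s\<^sup>2 \<le> 2\<delta>\<^sup>2 + 2\<alpha> \<parallel>x\<^sup>\<dagger>\<parallel>\<^sub>u \<parallel>e\<parallel>\<^bsub>2s-u\<^esub>\<close>.
  Interpolation between the indices \<open>-a\<close> and \<open>s\<close> bounds the last norm, the stability estimate bounds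
  \<open>\<parallel>e\<parallel>\<^bsub>-a\<^esub>\<close> by the residual, and with the chosen \<open>\<alpha>\<close> the resulting inequality
  scales; interpolating once more yields the rates.

  The stability constant is only under control on balls whose radius depends on \<open>\<parallel>x\<^sup>\<dagger>\<parallel>\<^sub>u\<close> alone,
  which requires \<open>\<delta> \<le> 1\<close>.  For \<open>\<delta> \<ge> 1\<close> stability is not needed: the comparison already gives the rate
  at index \<open>s\<close>, and the rates at smaller indices are weaker.  This also settles the degenerate
  case \<open>s = -a\<close>, in which \<open>u + a\<close> can vanish.

  The norms of the scale only involve the eigenprojections of \<open>L\<close>.  So it suffices that the eigenspaces
  are pairwise orthogonal and that the eigenvalues are bounded away from zero; the spectral theorem,
  i.e. completeness of the eigenspaces, plays no role.
\<close>

section \<open>Orthogonal projections\<close>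

text \<open>The parallelogram law makes a minimizing sequence for the distance from \<open>x\<close>
  to \<open>S\<close> Cauchy. Its limit attains the distance, and minimality along each line through
  it gives orthogonality.\<close>

lemma closed_subspace_projection:
  fixes S :: "'a::{real_inner,complete_space} set"
  assumes "closed S" and "subspace S"
  obtains y where "y \<in> S" and "\<And>z. z \<in> S \<Longrightarrow> inner (x - y) z = 0"
proof -
  define d where "d = (INF z\<in>S. (norm (x - z))\<^sup>2)"
  have "0 \<in> S" using assms(2) by (simp add: subspace_0)
  have bdd: "bdd_below ((\<lambda>z. (norm (x - z))\<^sup>2) ` S)"
    by (rule bdd_belowI2[of _ 0]) simp
  have d_le: "d \<le> (norm (x - z))\<^sup>2" if "z \<in> S" for z
    unfolding d_def by (rule cINF_lower[OF bdd that])
  have "\<exists>z\<in>S. (norm (x - z))\<^sup>2 < d + inverse (real (Suc n))" for n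
    using cINF_less_iff[of S "\<lambda>z. (norm (x - z))\<^sup>2" "d + inverse (real (Suc n))"] bdd \<open>0 \<in> S\<close>
    unfolding d_def by fastforce
  then obtain y where yS: "\<And>n. y n \<in> S"
    and y_less: "\<And>n. (norm (x - y n))\<^sup>2 < d + inverse (real (Suc n))"
    by metis
  have dist_y: "(norm (y m - y n))\<^sup>2 \<le> 2 * inverse (real (Suc m)) + 2 * inverse (real (Suc n))" for m n
  proof -
    \<comment> \<open>Midpoints stay in \<open>S\<close>, so the sum in the parallelogram identity
      has square at least \<open>4 * d\<close>; this forces the difference to be small.\<close>
    have half: "(1/2) *\<^sub>R (y m + y n) \<in> S"
      using assms(2) yS by (simp add: subspace_add subspace_scale)
    have "4 * d \<le> (norm (2 *\<^sub>R x - (y m + y n)))\<^sup>2"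
    proof -
      have "2 *\<^sub>R x - (y m + y n) = 2 *\<^sub>R (x - (1/2) *\<^sub>R (y m + y n))"
        by (simp add: algebra_simps)
      then have "(norm (2 *\<^sub>R x - (y m + y n)))\<^sup>2 = 4 * (norm (x - (1/2) *\<^sub>R (y m + y n)))\<^sup>2"
        by (simp only: norm_scaleR power_mult_distrib) simp
      with d_le[OF half] show ?thesis by linarith
    qed
    moreover have "(norm (y m - y n))\<^sup>2 + (norm (2 *\<^sub>R x - (y m + y n)))\<^sup>2
        = 2 * (norm (x - y m))\<^sup>2 + 2 * (norm (x - y n))\<^sup>2"
      unfolding power2_norm_eq_inner by (simp add: algebra_simps inner_commute)
    ultimately show ?thesis
      using y_less[of m] y_less[of n] by linarith
  qed
  have "Cauchy y"
  proof (rule metric_CauchyI)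
    fix e :: real assume "e > 0"
    then obtain N where N: "inverse (real (Suc N)) < e\<^sup>2 / 4"
      using reals_Archimedean[of "e\<^sup>2 / 4"] by auto
    have "dist (y m) (y n) < e" if "m \<ge> N" "n \<ge> N" for m n
    proof -
      have "inverse (real (Suc m)) \<le> inverse (real (Suc N))" "inverse (real (Suc n)) \<le> inverse (real (Suc N))"
        using that by (simp_all add: le_imp_inverse_le)
      then have "(dist (y m) (y n))\<^sup>2 < e\<^sup>2"
        using dist_y[of m n] N unfolding dist_norm by linarith
      then show ?thesis by (rule power2_less_imp_less) (use \<open>e > 0\<close> in simp)
    qed
    then show "\<exists>M. \<forall>m\<ge>M. \<forall>n\<ge>M. dist (y m) (y n) < e" by blast
  qed
  then obtain y' where lim: "y \<longlonglongrightarrow> y'"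
    using Cauchy_convergent convergentD by blast
  have "y' \<in> S"
    using closed_sequentially[OF assms(1) _ lim] yS by blast
  have "(\<lambda>n. (norm (x - y n))\<^sup>2) \<longlonglongrightarrow> (norm (x - y'))\<^sup>2"
    by (intro tendsto_intros lim)
  moreover have "(\<lambda>n. d + inverse (real (Suc n))) \<longlonglongrightarrow> d + 0"
    by (intro tendsto_intros LIMSEQ_inverse_real_of_nat)
  ultimately have y'_le: "(norm (x - y'))\<^sup>2 \<le> d"
    using y_less by (intro LIMSEQ_le[where Y="\<lambda>n. d + inverse (real (Suc n))"]) (auto intro: less_imp_le)
  have "inner (x - y') z = 0" if "z \<in> S" for z
  proof (cases "z = 0")
    case False
    \<comment> \<open>With this \<open>c\<close>, the point \<open>y' + c *\<^sub>R z\<close> is the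
      nearest one to \<open>x\<close> on the line through \<open>y'\<close> in direction
      \<open>z\<close>.\<close>
    define c where "c = inner (x - y') z / (norm z)\<^sup>2"
    have "y' + c *\<^sub>R z \<in> S"
      using assms(2) \<open>y' \<in> S\<close> that by (simp add: subspace_add subspace_scale)
    then have "(norm (x - y'))\<^sup>2 \<le> (norm (x - y' - c *\<^sub>R z))\<^sup>2"
      using d_le y'_le by (metis diff_diff_eq order_trans)
    also have "\<dots> = (norm (x - y'))\<^sup>2 - 2 * c * inner (x - y') z + c\<^sup>2 * (norm z)\<^sup>2"
      unfolding power2_norm_eq_inner by (simp add: algebra_simps inner_commute power2_eq_square)
    also have "\<dots> = (norm (x - y'))\<^sup>2 - (inner (x - y') z)\<^sup>2 / (norm z)\<^sup>2"
      using False by (simp add: c_def power2_eq_square field_simps)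
    finally have "(inner (x - y') z)\<^sup>2 / (norm z)\<^sup>2 \<le> 0" by linarith
    moreover have "(norm z)\<^sup>2 > 0" using False by simp
    ultimately have "(inner (x - y') z)\<^sup>2 \<le> 0" by (simp only: divide_le_0_iff) linarith
    then show ?thesis by simp
  qed simp
  with \<open>y' \<in> S\<close> show ?thesis by (rule that)
qed

section \<open>Calculus of the orthogonal projection\<close>

context
  fixes S :: "'a::{real_inner,complete_space} set"
  assumes S: "closed S" "subspace S"
begin

text \<open>Two candidates differ by an element of \<open>S\<close> that is orthogonal to itself;
  this uniqueness gives the \<open>THE\<close> in \<open>orth_proj\<close> its meaning.\<close>

lemma orth_proj_eqI:
  assumes "y \<in> S" and "\<And>z. z \<in> S \<Longrightarrow> inner (x - y) z = 0"
  shows "orth_proj S x = y"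
  unfolding orth_proj_def
proof (rule the_equality)
  fix y' assume y': "y' \<in> S \<and> (\<forall>z\<in>S. inner (x - y') z = 0)"
  have "y' - y \<in> S" using y' assms(1) S(2) by (simp add: subspace_diff)
  then have "inner ((x - y) - (x - y')) (y' - y) = 0"
    using y' assms(2) by (simp add: inner_diff_left)
  then show "y' = y" by simp
qed (use assms in blast)

lemma orth_proj_mem: "orth_proj S x \<in> S"
  using closed_subspace_projection[OF S] orth_proj_eqI by metis

lemma orth_proj_orthogonal: "z \<in> S \<Longrightarrow> inner (x - orth_proj S x) z = 0"
  using closed_subspace_projection[OF S] orth_proj_eqI by metis

lemma orth_proj_diff: "orth_proj S (x - y) = orth_proj S x - orth_proj S y"
proof (rule orth_proj_eqI)
  fix z assume "z \<in> S"
  then have "inner (x - orth_proj S x) z - inner (y - orth_proj S y) z = 0"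
    by (simp add: orth_proj_orthogonal)
  then show "inner (x - y - (orth_proj S x - orth_proj S y)) z = 0"
    by (simp add: inner_diff_left)
qed (simp add: subspace_diff S orth_proj_mem)

end

section \<open>Orthogonal series\<close>

text \<open>By continuity of the inner product, pairing \<open>f i\<close> with the limit
  \<open>y\<close> leaves only the diagonal term, and pairing \<open>x\<close> with \<open>y\<close>
  sums these terms. For \<open>f = g\<close> this is Parseval's identity.\<close>

lemma has_sum_inner_orthogonal:
  fixes f g :: "'i \<Rightarrow> 'a::real_inner"
  assumes "(f has_sum x) A" and "(g has_sum y) A"
    and "\<And>i j. i \<in> A \<Longrightarrow> j \<in> A \<Longrightarrow> i \<noteq> j \<Longrightarrow> inner (f i) (g j) = 0"
  shows "((\<lambda>i. inner (f i) (g i)) has_sum inner x y) A"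
proof -
  have "inner (f i) y = inner (f i) (g i)" if "i \<in> A" for i
  proof -
    have "((\<lambda>j. inner (f i) (g j)) has_sum inner (f i) y) A"
      by (rule has_sum_bounded_linear[OF bounded_linear_inner_right assms(2)])
    moreover have "((\<lambda>j. inner (f i) (g j)) has_sum inner (f i) (g i)) A \<longleftrightarrow>
        ((\<lambda>j. inner (f i) (g j)) has_sum inner (f i) (g i)) {i}"
      by (rule has_sum_cong_neutral) (use that assms(3) in auto)
    then have "((\<lambda>j. inner (f i) (g j)) has_sum inner (f i) (g i)) A"
      by (simp add: has_sum_finiteI)
    ultimately show ?thesis by (rule has_sum_unique)
  qed
  moreover have "((\<lambda>i. inner (f i) y) has_sum inner x y) A"
    by (rule has_sum_bounded_linear[OF bounded_linear_inner_left assms(1)])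
  ultimately show ?thesis by (simp cong: has_sum_cong)
qed

text \<open>Pythagoras turns increments of the vector sums into increments of the real series, so
  the net of finite partial sums is Cauchy, and completeness yields a limit.\<close>

lemma summable_on_orthogonal:
  fixes f :: "'i \<Rightarrow> 'a::{real_inner,complete_space}"
  assumes orth: "\<And>i j. i \<in> A \<Longrightarrow> j \<in> A \<Longrightarrow> i \<noteq> j \<Longrightarrow> inner (f i) (f j) = 0"
    and summable: "(\<lambda>i. (norm (f i))\<^sup>2) summable_on A"
  shows "f summable_on A"
proof -
  have "\<exists>P. eventually P (finite_subsets_at_top A) \<and>
              (\<forall>F F'. P F \<and> P F' \<longrightarrow> dist (sum f F) (sum f F') < e)" if "e > 0" for e
  proof -
    obtain F0 where F0: "finite F0" "F0 \<subseteq> A"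
      and dist0: "dist (\<Sum>i\<in>F0. (norm (f i))\<^sup>2) (\<Sum>\<^sub>\<infinity>i\<in>A. (norm (f i))\<^sup>2) \<le> (e/3)\<^sup>2"
      using infsum_finite_approximation[OF summable, of "(e/3)\<^sup>2"] \<open>e > 0\<close> by auto
    \<comment> \<open>Any two finite sets above \<open>F0\<close> are compared through
      \<open>F0\<close>, at a cost of at most \<open>2 * e / 3\<close>.\<close>
    define P where "P F \<longleftrightarrow> finite F \<and> F0 \<subseteq> F \<and> F \<subseteq> A" for F
    have near: "dist (sum f F) (sum f F0) \<le> e/3" if "P F" for F
    proof -
      have F: "finite F" "F0 \<subseteq> F" "F \<subseteq> A" using that by (auto simp: P_def)
      have "(dist (sum f F) (sum f F0))\<^sup>2 = (norm (sum f (F - F0)))\<^sup>2"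
        unfolding dist_norm using F by (subst sum_diff) auto
      also have "\<dots> = (\<Sum>i\<in>F - F0. (norm (f i))\<^sup>2)"
        by (rule norm_sum_Pythagorean)
          (use F orth in \<open>simp_all add: pairwise_def orthogonal_def subset_iff\<close>)
      also have "\<dots> = (\<Sum>i\<in>F. (norm (f i))\<^sup>2) - (\<Sum>i\<in>F0. (norm (f i))\<^sup>2)"
        using F by (subst sum_diff) auto
      also have "\<dots> \<le> (\<Sum>\<^sub>\<infinity>i\<in>A. (norm (f i))\<^sup>2) - (\<Sum>i\<in>F0. (norm (f i))\<^sup>2)"
        using finite_sum_le_infsum[OF summable F(1) F(3)] by simp
      also have "\<dots> \<le> (e/3)\<^sup>2"
        using dist0 by (simp add: dist_real_def)
      finally show ?thesis by (rule power2_le_imp_le) (use \<open>e > 0\<close> in simp)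
    qed
    have "dist (sum f F) (sum f F') < e" if "P F" "P F'" for F F'
      using near[OF that(1)] near[OF that(2)] \<open>e > 0\<close>
        dist_triangle2[of "sum f F" "sum f F'" "sum f F0"] by linarith
    moreover have "eventually P (finite_subsets_at_top A)"
      unfolding P_def eventually_finite_subsets_at_top using F0 by blast
    ultimately show ?thesis by blast
  qed
  then have "cauchy_filter (filtermap (sum f) (finite_subsets_at_top A))"
    by (simp add: cauchy_filter_metric_filtermap)
  moreover have "complete (UNIV::'a set)"
    by (meson Cauchy_convergent UNIV_I complete_def convergent_def)
  ultimately obtain x where "(sum f \<longlongrightarrow> x) (finite_subsets_at_top A)"
    using complete_uniform[where S=UNIV] by (force simp add: filterlim_def)
  then show ?thesis
    using summable_on_def has_sum_def by blast
qed

text \<open>Both sums are normalized to one and the weighted Young inequality is applied termwise.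
  Writing the exponents as \<open>1 - \<theta>\<close> and \<open>\<theta>\<close> includes the
  endpoints.\<close>

lemma Hoelder_infsum_powr:
  fixes f g :: "'i \<Rightarrow> real"
  assumes "f summable_on A" and "g summable_on A"
    and "\<And>i. i \<in> A \<Longrightarrow> f i \<ge> 0" and "\<And>i. i \<in> A \<Longrightarrow> g i \<ge> 0"
    and "(\<lambda>i. f i powr (1 - \<theta>) * g i powr \<theta>) summable_on A"
    and "0 \<le> \<theta>" "\<theta> \<le> 1"
  shows "(\<Sum>\<^sub>\<infinity>i\<in>A. f i powr (1 - \<theta>) * g i powr \<theta>) \<le> (infsum f A) powr (1 - \<theta>) * (infsum g A) powr \<theta>"
proof (cases "infsum f A = 0 \<or> infsum g A = 0")
  \<comment> \<open>Normalizing is impossible here. A vanishing sum of nonnegative terms has only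
    zero terms, and \<open>0 powr c = 0\<close> even for \<open>c = 0\<close>.\<close>
  case True
  have "f i powr (1 - \<theta>) * g i powr \<theta> = 0" if "i \<in> A" for i
    using True nonneg_infsum_le_0D[OF _ assms(1,3) that] nonneg_infsum_le_0D[OF _ assms(2,4) that]
    by auto
  then have "(\<Sum>\<^sub>\<infinity>i\<in>A. f i powr (1 - \<theta>) * g i powr \<theta>) = 0" by (rule infsum_0)
  then show ?thesis by simp
next
  case False
  define a b where "a = infsum f A" and "b = infsum g A"
  have pos: "a > 0" "b > 0"
    using False infsum_nonneg[of A f] infsum_nonneg[of A g] assms(3,4) unfolding a_def b_def by force+
  have "(\<Sum>\<^sub>\<infinity>i\<in>A. f i powr (1 - \<theta>) * g i powr \<theta>)
      \<le> (\<Sum>\<^sub>\<infinity>i\<in>A. a powr (1 - \<theta>) * b powr \<theta> * ((1 - \<theta>) / a * f i + \<theta> / b * g i))"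
  proof (rule infsum_mono)
    fix i assume "i \<in> A"
    show "f i powr (1 - \<theta>) * g i powr \<theta> \<le> a powr (1 - \<theta>) * b powr \<theta> * ((1 - \<theta>) / a * f i + \<theta> / b * g i)"
    proof (cases "f i = 0 \<or> g i = 0")
      case True
      then show ?thesis using assms(3,4)[OF \<open>i \<in> A\<close>] assms(6,7) pos by auto
    next
      case False
      then have "f i > 0" "g i > 0" using assms(3,4)[OF \<open>i \<in> A\<close>] by auto
      then have "(f i / a) powr (1 - \<theta>) * (g i / b) powr \<theta> \<le> (1 - \<theta>) * (f i / a) + \<theta> * (g i / b)"
        using Youngs_inequality_0[of "1 - \<theta>" \<theta> "f i / a" "g i / b"] assms(6,7) pos by simp
      then have "a powr (1 - \<theta>) * b powr \<theta> * ((f i / a) powr (1 - \<theta>) * (g i / b) powr \<theta>)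
          \<le> a powr (1 - \<theta>) * b powr \<theta> * ((1 - \<theta>) * (f i / a) + \<theta> * (g i / b))"
        by (intro mult_left_mono) auto
      then show ?thesis
        using pos \<open>f i > 0\<close> \<open>g i > 0\<close> by (simp add: powr_divide)
    qed
  qed (intro assms summable_on_add summable_on_cmult_right)+
  also have "\<dots> = a powr (1 - \<theta>) * b powr \<theta> * ((1 - \<theta>) / a * a + \<theta> / b * b)"
    by (rule infsumI, intro has_sum_cmult_right has_sum_add) (simp_all add: a_def b_def assms(1,2))
  also have "\<dots> = a powr (1 - \<theta>) * b powr \<theta>" using pos by simp
  finally show ?thesis by (simp add: a_def b_def)
qed

lemma power2_powr: "0 \<le> (x::real) \<Longrightarrow> (x\<^sup>2) powr c = (x powr c)\<^sup>2"
  by (simp add: power2_eq_square powr_mult)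

section \<open>Hilbert scales\<close>

locale hilbert_scale =
  fixes DL :: "'a::{real_inner,complete_space} set" and L :: "'a \<Rightarrow> 'a"
  assumes generator: "hilbert_scale_generator DL L"
begin

text \<open>Self-adjointness turns the eigenvalue equation into a weak one, with membership in the
  domain built in. Each test condition is linear and continuous in \<open>x\<close>, whence
  eigenspaces are closed subspaces.\<close>

lemma eigenspace_iff: "x \<in> eigenspace DL L \<mu> \<longleftrightarrow> (\<forall>y\<in>DL. inner (L y) x = inner y (\<mu> *\<^sub>R x))"
proof -
  have "(\<forall>y\<in>DL. inner (L y) x = inner y (\<mu> *\<^sub>R x)) \<longleftrightarrow> x \<in> DL \<and> \<mu> *\<^sub>R x = L x"
    using generator unfolding hilbert_scale_generator_def self_adjoint_operator_def by blast
  then show ?thesis by (auto simp only: eigenspace_def mem_Collect_eq)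
qed

lemma closed_eigenspace: "closed (eigenspace DL L \<mu>)"
proof -
  have "eigenspace DL L \<mu> = (\<Inter>y\<in>DL. {x. inner (L y) x = inner y (\<mu> *\<^sub>R x)})"
    using eigenspace_iff by blast
  also have "closed \<dots>"
    by (intro closed_INT ballI closed_Collect_eq continuous_intros)
  finally show ?thesis .
qed

lemma subspace_eigenspace: "subspace (eigenspace DL L \<mu>)"
  by (auto simp: subspace_def eigenspace_iff inner_add_right distrib_left)

lemmas eigenspace_projection = closed_eigenspace subspace_eigenspace

lemma eigenspaces_orthogonal:
  assumes "x \<in> eigenspace DL L \<mu>" and "y \<in> eigenspace DL L \<nu>" and "\<mu> \<noteq> \<nu>"
  shows "inner x y = 0"
proof -
  have x: "x \<in> DL" "L x = \<mu> *\<^sub>R x" using assms(1) by (auto simp: eigenspace_def)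
  then have "inner (L x) y = inner x (\<nu> *\<^sub>R y)" using assms(2) eigenspace_iff by blast
  then have "\<mu> * inner x y = \<nu> * inner x y" by (simp add: x(2))
  with assms(3) show ?thesis by simp
qed

text \<open>The compact inverse is bounded on the unit ball of the range, which keeps the
  eigenvalues away from zero. Asking for \<open>c \<le> 1\<close> makes the powers of
  \<open>c\<close> nonincreasing in the exponent.\<close>

lemma eigenvalues_bounded_below: "\<exists>c>0. c \<le> 1 \<and> (\<forall>\<mu>\<in>eigenvalues DL L. c \<le> \<bar>\<mu>\<bar>)"
proof -
  have inj: "inj_on L DL" and sub: "subspace DL"
    and scale: "\<And>c x. x \<in> DL \<Longrightarrow> L (c *\<^sub>R x) = c *\<^sub>R L x"
    and "bounded (closure (inv_into DL L ` (L ` DL \<inter> cball 0 1)))"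
    using generator unfolding hilbert_scale_generator_def linear_operator_on_def
    by (auto intro: compact_imp_bounded)
  then have "bounded (inv_into DL L ` (L ` DL \<inter> cball 0 1))"
    by (meson bounded_subset closure_subset)
  then obtain M where M: "M > 0" "\<And>w. w \<in> inv_into DL L ` (L ` DL \<inter> cball 0 1) \<Longrightarrow> norm w \<le> M"
    using bounded_pos by metis
  have "1 / M \<le> \<bar>\<mu>\<bar>" if \<mu>: "\<mu> \<in> eigenvalues DL L" for \<mu>
  proof -
    obtain v where v: "v \<in> DL" "L v = \<mu> *\<^sub>R v" "v \<noteq> 0"
      using \<mu> unfolding eigenvalues_def eigenspace_def by auto
    have "\<mu> \<noteq> 0"
    proof
      assume "\<mu> = 0"
      then have "L v = L 0"
        using v scale[of 0 0] sub by (simp add: subspace_0)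
      then show False using inj v sub by (metis inj_onD subspace_0)
    qed
    \<comment> \<open>Scaled so that \<open>L w\<close> has norm one while \<open>w\<close> itself
      has norm \<open>1 / \<bar>\<mu>\<bar>\<close>.\<close>
    define w where "w = (1 / (\<bar>\<mu>\<bar> * norm v)) *\<^sub>R v"
    have "w \<in> DL" using v sub by (simp add: w_def subspace_scale)
    moreover have "norm (L w) \<le> 1"
      unfolding w_def using v \<open>\<mu> \<noteq> 0\<close> by (simp add: scale)
    ultimately have "inv_into DL L (L w) \<in> inv_into DL L ` (L ` DL \<inter> cball 0 1)"
      by auto
    then have "norm w \<le> M" using M(2) inj \<open>w \<in> DL\<close> by force
    moreover have "norm w = 1 / \<bar>\<mu>\<bar>" using v \<open>\<mu> \<noteq> 0\<close> by (simp add: w_def)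
    ultimately show ?thesis using M(1) \<open>\<mu> \<noteq> 0\<close> by (simp add: field_simps)
  qed
  then have "\<forall>\<mu>\<in>eigenvalues DL L. min 1 (1 / M) \<le> \<bar>\<mu>\<bar>" by (simp add: min.coboundedI2)
  moreover have "0 < min 1 (1 / M)" using M(1) by simp
  ultimately show ?thesis by (meson min.cobounded1)
qed

lemma eigenvalue_nonzero: "\<mu> \<in> eigenvalues DL L \<Longrightarrow> \<mu> \<noteq> 0"
  by (metis abs_zero eigenvalues_bounded_below not_le)

section \<open>Powers as orthogonal series; embedding, duality and interpolation\<close>

lemma power_summand_orthogonal:
  "\<mu> \<noteq> \<nu> \<Longrightarrow> inner (power_summand DL L t x \<mu>) (power_summand DL L r y \<nu>) = 0"
  unfolding power_summand_def inner_scaleR_left inner_scaleR_right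
  by (metis eigenspaces_orthogonal orth_proj_mem[OF eigenspace_projection] mult_zero_right)

lemma op_power_has_sum:
  "x \<in> scale_space DL L t \<Longrightarrow> (power_summand DL L t x has_sum op_power DL L t x) (eigenvalues DL L)"
  unfolding scale_space_def op_power_def by simp

text \<open>Parseval's identity, by which norms of the scale become real series that can be compared
  termwise.\<close>

lemma norm_op_power_has_sum:
  assumes "x \<in> scale_space DL L t"
  shows "((\<lambda>\<mu>. (norm (power_summand DL L t x \<mu>))\<^sup>2) has_sum (norm (op_power DL L t x))\<^sup>2) (eigenvalues DL L)"
  using has_sum_inner_orthogonal[OF op_power_has_sum[OF assms] op_power_has_sum[OF assms]]
  by (simp add: power_summand_orthogonal power2_norm_eq_inner)

lemma scale_spaceI:
  "(\<lambda>\<mu>. (norm (power_summand DL L t x \<mu>))\<^sup>2) summable_on eigenvalues DL L \<Longrightarrow> x \<in> scale_space DL L t"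
  unfolding scale_space_def by (simp add: summable_on_orthogonal power_summand_orthogonal)

lemma op_power_diff_has_sum:
  assumes "x \<in> scale_space DL L t" and "y \<in> scale_space DL L t"
  shows "(power_summand DL L t (x - y) has_sum op_power DL L t x - op_power DL L t y) (eigenvalues DL L)"
proof -
  have "power_summand DL L t (x - y) = (\<lambda>\<mu>. power_summand DL L t x \<mu> + - power_summand DL L t y \<mu>)"
    unfolding power_summand_def
    by (simp add: orth_proj_diff[OF eigenspace_projection] scaleR_diff_right)
  moreover have "((\<lambda>\<mu>. power_summand DL L t x \<mu> + - power_summand DL L t y \<mu>) has_sum
      (op_power DL L t x + - op_power DL L t y)) (eigenvalues DL L)"
    by (intro has_sum_add) (simp_all add: has_sum_uminus op_power_has_sum assms)
  ultimately show ?thesis by simp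
qed

lemma scale_space_diff:
  "x \<in> scale_space DL L t \<Longrightarrow> y \<in> scale_space DL L t \<Longrightarrow> x - y \<in> scale_space DL L t"
  using op_power_diff_has_sum unfolding scale_space_def by (auto intro: has_sum_imp_summable)

lemma op_power_diff:
  "x \<in> scale_space DL L t \<Longrightarrow> y \<in> scale_space DL L t \<Longrightarrow>
    op_power DL L t (x - y) = op_power DL L t x - op_power DL L t y"
  unfolding op_power_def[of _ _ _ "x - y"] by (rule infsumI[OF op_power_diff_has_sum])

text \<open>Since \<open>r \<le> t\<close>, the factor \<open>\<bar>\<mu>\<bar> powr (r - t)\<close>
  is at most \<open>c powr (r - t)\<close>; the series of squared norms are then compared
  termwise.\<close>

lemma scale_embedding:
  assumes c: "c > 0" "\<And>\<mu>. \<mu> \<in> eigenvalues DL L \<Longrightarrow> c \<le> \<bar>\<mu>\<bar>"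
    and "r \<le> t" and x: "x \<in> scale_space DL L t"
  shows "x \<in> scale_space DL L r"
    and "norm (op_power DL L r x) \<le> c powr (r - t) * norm (op_power DL L t x)"
proof -
  have le: "(norm (power_summand DL L r x \<mu>))\<^sup>2 \<le> (c powr (r - t))\<^sup>2 * (norm (power_summand DL L t x \<mu>))\<^sup>2"
    if "\<mu> \<in> eigenvalues DL L" for \<mu>
  proof -
    have "\<bar>\<mu>\<bar> powr r = \<bar>\<mu>\<bar> powr (r - t) * \<bar>\<mu>\<bar> powr t"
      using eigenvalue_nonzero[OF that] by (simp flip: powr_add)
    also have "\<dots> \<le> c powr (r - t) * \<bar>\<mu>\<bar> powr t"
      using c that \<open>r \<le> t\<close> by (intro mult_right_mono powr_mono2') auto
    finally have "norm (power_summand DL L r x \<mu>) \<le> c powr (r - t) * norm (power_summand DL L t x \<mu>)"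
      unfolding power_summand_def by (simp add: mult_right_mono flip: mult.assoc)
    then show ?thesis by (metis norm_ge_zero power_mono power_mult_distrib)
  qed
  note sum_t = norm_op_power_has_sum[OF x, THEN has_sum_cmult_right, of "(c powr (r - t))\<^sup>2"]
  show *: "x \<in> scale_space DL L r"
    by (rule scale_spaceI, rule summable_on_comparison_test[OF has_sum_imp_summable[OF sum_t]])
      (use le in auto)
  have "(norm (op_power DL L r x))\<^sup>2 \<le> (c powr (r - t) * norm (op_power DL L t x))\<^sup>2"
    using has_sum_mono[OF norm_op_power_has_sum[OF *] sum_t] le by (simp add: power_mult_distrib)
  then show "norm (op_power DL L r x) \<le> c powr (r - t) * norm (op_power DL L t x)"
    by (rule power2_le_imp_le) simp
qed

text \<open>Duality in the scale: expanded in eigenprojections, both inner products have the same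
  summands because \<open>t + u = 2 * s\<close>.\<close>

lemma inner_op_power_shift:
  assumes "x \<in> scale_space DL L s" "y \<in> scale_space DL L s"
    and "x \<in> scale_space DL L t" "y \<in> scale_space DL L u" and "t + u = 2 * s"
  shows "inner (op_power DL L s x) (op_power DL L s y) = inner (op_power DL L t x) (op_power DL L u y)"
proof -
  have "inner (power_summand DL L s x \<mu>) (power_summand DL L s y \<mu>) =
      inner (power_summand DL L t x \<mu>) (power_summand DL L u y \<mu>)" for \<mu>
  proof -
    have "\<bar>\<mu>\<bar> powr s * \<bar>\<mu>\<bar> powr s = \<bar>\<mu>\<bar> powr t * \<bar>\<mu>\<bar> powr u"
      using assms(5) by (simp flip: powr_add)
    then show ?thesis by (simp add: power_summand_def flip: mult.assoc)
  qed
  then show ?thesis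
    using has_sum_inner_orthogonal[OF op_power_has_sum[OF assms(1)] op_power_has_sum[OF assms(2)]]
      has_sum_inner_orthogonal[OF op_power_has_sum[OF assms(3)] op_power_has_sum[OF assms(4)]]
    by (simp add: power_summand_orthogonal has_sum_unique)
qed

text \<open>Hoelder's inequality for the squared norms of the summands: the one at index
  \<open>r\<close> is the weighted geometric mean of those at \<open>p\<close> and
  \<open>q\<close>.\<close>

lemma interpolation:
  assumes x: "x \<in> scale_space DL L p" "x \<in> scale_space DL L q" "x \<in> scale_space DL L r"
    and \<theta>: "0 \<le> \<theta>" "\<theta> \<le> 1" and r: "r = (1 - \<theta>) * p + \<theta> * q"
  shows "norm (op_power DL L r x) \<le>
    norm (op_power DL L p x) powr (1 - \<theta>) * norm (op_power DL L q x) powr \<theta>"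
proof -
  define f where "f t \<mu> = (norm (power_summand DL L t x \<mu>))\<^sup>2" for t \<mu>
  note has_sum = norm_op_power_has_sum[OF x(1), folded f_def]
    norm_op_power_has_sum[OF x(2), folded f_def] norm_op_power_has_sum[OF x(3), folded f_def]
  have f_r: "f p \<mu> powr (1 - \<theta>) * f q \<mu> powr \<theta> = f r \<mu>" if "\<mu> \<in> eigenvalues DL L" for \<mu>
  proof -
    define n where "n = norm (orth_proj (eigenspace DL L \<mu>) x)"
    have n: "n \<ge> 0" by (simp add: n_def)
    have "(\<bar>\<mu>\<bar> powr p * n) powr (1 - \<theta>) * (\<bar>\<mu>\<bar> powr q * n) powr \<theta>
        = (\<bar>\<mu>\<bar> powr (p * (1 - \<theta>)) * \<bar>\<mu>\<bar> powr (q * \<theta>)) * (n powr (1 - \<theta>) * n powr \<theta>)"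
      using n by (simp add: powr_mult powr_powr)
    also have "\<dots> = \<bar>\<mu>\<bar> powr r * n"
      using n by (simp add: r algebra_simps flip: powr_add)
    finally show ?thesis
      using n unfolding f_def power_summand_def n_def
      by (simp add: power2_powr flip: power_mult_distrib)
  qed
  have "(norm (op_power DL L r x))\<^sup>2 = (\<Sum>\<^sub>\<infinity>\<mu>\<in>eigenvalues DL L. f p \<mu> powr (1 - \<theta>) * f q \<mu> powr \<theta>)"
    using infsumI[OF has_sum(3)] by (simp add: f_r cong: infsum_cong)
  also have "\<dots> \<le> infsum (f p) (eigenvalues DL L) powr (1 - \<theta>) * infsum (f q) (eigenvalues DL L) powr \<theta>"
  proof (rule Hoelder_infsum_powr)
    show "(\<lambda>\<mu>. f p \<mu> powr (1 - \<theta>) * f q \<mu> powr \<theta>) summable_on eigenvalues DL L"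
      using has_sum_imp_summable[OF has_sum(3)] by (simp add: f_r cong: summable_on_cong)
    show "f p summable_on eigenvalues DL L" "f q summable_on eigenvalues DL L"
      using has_sum(1,2) has_sum_imp_summable by blast+
  qed (simp_all add: f_def \<theta>)
  also have "\<dots> = (norm (op_power DL L p x) powr (1 - \<theta>) * norm (op_power DL L q x) powr \<theta>)\<^sup>2"
    using infsumI[OF has_sum(1)] infsumI[OF has_sum(2)] by (simp add: power2_powr power_mult_distrib)
  finally show ?thesis by (rule power2_le_imp_le) simp
qed

end

section \<open>Tikhonov regularization\<close>

text \<open>The infimum is at most the value at \<open>xd\<close>. One
  \<open>\<delta>\<^sup>2\<close> is the misfit of \<open>xd\<close>, the other the tolerance of the
  approximate minimizers. Membership in the space of index \<open>s\<close> holds because the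
  functional is infinite outside it.\<close>

lemma approx_minimizer_bound:
  fixes F :: "'a::{real_inner,complete_space} \<Rightarrow> 'b::real_inner"
  assumes x: "x \<in> approx_minimizers DL L D F s \<delta> \<alpha> yd" and "\<alpha> > 0"
    and xd: "xd \<in> D" "xd \<in> scale_space DL L s" and noise: "norm (yd - F xd) \<le> \<delta>"
  shows "x \<in> D" and "x \<in> scale_space DL L s"
    and "(norm (F x - yd))\<^sup>2 + \<alpha> * (norm (op_power DL L s x))\<^sup>2
      \<le> 2 * \<delta>\<^sup>2 + \<alpha> * (norm (op_power DL L s xd))\<^sup>2"
proof -
  have tikhonov_eq: "tikhonov DL L F s \<alpha> yd z = ennreal ((norm (F z - yd))\<^sup>2 + \<alpha> * (norm (op_power DL L s z))\<^sup>2)"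
    if "z \<in> scale_space DL L s" for z
    using that \<open>\<alpha> > 0\<close> by (simp add: tikhonov_def scale_norm_def ennreal_power flip: ennreal_mult ennreal_plus)
  have "tikhonov DL L F s \<alpha> yd x \<le> (INF z\<in>D. tikhonov DL L F s \<alpha> yd z) + ennreal (\<delta>\<^sup>2)"
    using x by (simp add: approx_minimizers_def)
  also have "\<dots> \<le> tikhonov DL L F s \<alpha> yd xd + ennreal (\<delta>\<^sup>2)"
    by (intro add_right_mono INF_lower xd)
  also have "\<dots> = ennreal ((norm (F xd - yd))\<^sup>2 + \<alpha> * (norm (op_power DL L s xd))\<^sup>2 + \<delta>\<^sup>2)"
    using \<open>\<alpha> > 0\<close> by (simp add: tikhonov_eq xd)
  finally have le: "tikhonov DL L F s \<alpha> yd x \<le> \<dots>" .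
  show "x \<in> D" using x by (simp add: approx_minimizers_def)
  show mem: "x \<in> scale_space DL L s"
  proof (rule ccontr)
    assume "x \<notin> scale_space DL L s"
    then have "tikhonov DL L F s \<alpha> yd x = \<infinity>"
      using \<open>\<alpha> > 0\<close> by (simp add: tikhonov_def scale_norm_def ennreal_mult_top power2_eq_square)
    with le show False by (simp add: top_unique)
  qed
  have "(norm (F x - yd))\<^sup>2 + \<alpha> * (norm (op_power DL L s x))\<^sup>2
      \<le> (norm (F xd - yd))\<^sup>2 + \<alpha> * (norm (op_power DL L s xd))\<^sup>2 + \<delta>\<^sup>2"
    using le \<open>\<alpha> > 0\<close> unfolding tikhonov_eq[OF mem] by (subst (asm) ennreal_le_iff) auto
  moreover have "(norm (F xd - yd))\<^sup>2 \<le> \<delta>\<^sup>2"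
    using noise by (simp add: norm_minus_commute power_mono)
  ultimately show "(norm (F x - yd))\<^sup>2 + \<alpha> * (norm (op_power DL L s x))\<^sup>2
      \<le> 2 * \<delta>\<^sup>2 + \<alpha> * (norm (op_power DL L s xd))\<^sup>2" by linarith
qed

text \<open>
  In the scaled quantities \<open>t / \<delta>\<close> and \<open>h / \<delta> powr p\<close> all powers of \<open>\<delta>\<close> cancel:
  this is what singles out the parameter choice for \<open>\<alpha>\<close>.
\<close>

lemma rescaled_error_bound:
  fixes \<delta> \<gamma> \<theta> p E M t h m k Z :: real
  assumes "\<delta> > 0" and \<gamma>: "0 < \<gamma>" "\<gamma> \<le> 1" and \<theta>: "0 \<le> \<theta>" "\<theta> \<le> 1"
    and p: "p * (1 + \<theta>) = \<gamma> * \<theta>"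
    and "E \<ge> 0" "M \<ge> 1" "t \<ge> 0" "h \<ge> 0" "m \<ge> 0"
    and m: "m \<le> M * (t + \<delta>) powr \<gamma>"
    and k: "k \<le> h powr (1 - \<theta>) * m powr \<theta>"
    and main: "t\<^sup>2 + \<delta> powr (2 - 2 * p) * h\<^sup>2 \<le> 2 * \<delta>\<^sup>2 + 2 * \<delta> powr (2 - 2 * p) * (E * k)"
    and Z: "Z = 9 + 6 * E * M"
  shows "t \<le> Z * \<delta>" and "h \<le> Z * \<delta> powr p" and "m \<le> M * Z * \<delta> powr \<gamma>"
proof -
  define \<tau> \<eta> where "\<tau> = t / \<delta>" and "\<eta> = h / \<delta> powr p"
  \<comment> \<open>All scaled unknowns are bounded linearly in \<open>z\<close>, so that everything
    reduces to one inequality \<open>z\<^sup>2 \<le> Z * z\<close>.\<close>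
  define z where "z = 1 + \<tau> + \<eta>"
  have t: "t = \<delta> * \<tau>" and h: "h = \<delta> powr p * \<eta>" using \<open>\<delta> > 0\<close> by (simp_all add: \<tau>_def \<eta>_def)
  have nonneg: "\<tau> \<ge> 0" "\<eta> \<ge> 0" using assms by (simp_all add: \<tau>_def \<eta>_def)
  then have z: "z \<ge> 1" "\<tau> + 1 \<le> z" "\<eta> \<le> z" by (simp_all add: z_def)
  \<comment> \<open>Here \<open>\<gamma> \<le> 1\<close> enters: the power of a number not below one
    is at most that number.\<close>
  have "(\<tau> + 1) powr \<gamma> \<le> (\<tau> + 1) powr 1" using \<gamma> nonneg by (intro powr_mono) auto
  then have "(\<tau> + 1) powr \<gamma> \<le> z" using nonneg z by simp
  moreover have "t + \<delta> = \<delta> * (\<tau> + 1)" by (simp add: t algebra_simps)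
  ultimately have "(t + \<delta>) powr \<gamma> \<le> \<delta> powr \<gamma> * z"
    using nonneg \<open>\<delta> > 0\<close> by (simp add: powr_mult mult_left_mono)
  then have "M * (t + \<delta>) powr \<gamma> \<le> M * (\<delta> powr \<gamma> * z)" using \<open>M \<ge> 1\<close> by (intro mult_left_mono) auto
  with m have m_le: "m \<le> M * z * \<delta> powr \<gamma>" by (simp add: algebra_simps)
  have h_le: "h \<le> z * \<delta> powr p"
    using z \<open>\<delta> > 0\<close> by (simp add: h mult.commute mult_left_mono)
  have "k \<le> (z * \<delta> powr p) powr (1 - \<theta>) * (M * z * \<delta> powr \<gamma>) powr \<theta>"
    by (rule order_trans[OF k]) (use h_le m_le \<theta> assms in \<open>auto intro!: mult_mono powr_mono2\<close>)
  also have "\<dots> = M powr \<theta> * (z powr (1 - \<theta>) * z powr \<theta>) * (\<delta> powr (p * (1 - \<theta>)) * \<delta> powr (\<gamma> * \<theta>))"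
    using z \<open>M \<ge> 1\<close> by (simp add: powr_mult powr_powr)
  also have "z powr (1 - \<theta>) * z powr \<theta> = z" using z by (simp flip: powr_add)
  \<comment> \<open>The relation for \<open>p\<close> replaces \<open>\<gamma> * \<theta>\<close> by
    \<open>p * (1 + \<theta>)\<close>, so the exponents add up to \<open>2 * p\<close>, which
    \<open>\<delta> powr (2 - 2 * p)\<close> completes to \<open>\<delta>\<^sup>2\<close>.\<close>
  also have "\<delta> powr (p * (1 - \<theta>)) * \<delta> powr (\<gamma> * \<theta>) = \<delta> powr (2 * p)"
    unfolding p[symmetric] by (simp add: algebra_simps flip: powr_add)
  also have "M powr \<theta> * z * \<delta> powr (2 * p) \<le> M * z * \<delta> powr (2 * p)"
    using powr_mono[of \<theta> 1 M] \<theta> \<open>M \<ge> 1\<close> z by (intro mult_right_mono) auto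
  finally have k_le: "k \<le> M * z * \<delta> powr (2 * p)" .
  have cancel: "\<delta> powr (2 - 2 * p) * \<delta> powr (2 * p) = \<delta>\<^sup>2"
    using \<open>\<delta> > 0\<close> by (simp flip: powr_add)
  have "h\<^sup>2 = \<delta> powr (2 * p) * \<eta>\<^sup>2"
    by (simp add: h power_mult_distrib power2_eq_square flip: powr_add)
  then have "\<delta>\<^sup>2 * (\<tau>\<^sup>2 + \<eta>\<^sup>2) = t\<^sup>2 + \<delta> powr (2 - 2 * p) * h\<^sup>2"
    unfolding t cancel[symmetric] by (simp add: algebra_simps power_mult_distrib flip: cancel)
  also have "\<dots> \<le> 2 * \<delta>\<^sup>2 + 2 * \<delta> powr (2 - 2 * p) * (E * (M * z * \<delta> powr (2 * p)))"
    using main mult_left_mono[OF mult_left_mono[OF k_le \<open>E \<ge> 0\<close>], of "2 * \<delta> powr (2 - 2 * p)"] by simp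
  also have "\<dots> = \<delta>\<^sup>2 * (2 + 2 * E * M * z)"
    by (simp add: algebra_simps flip: cancel)
  finally have "\<tau>\<^sup>2 + \<eta>\<^sup>2 \<le> 2 + 2 * E * M * z" using \<open>\<delta> > 0\<close> by simp
  then have "3 * (1 + (\<tau>\<^sup>2 + \<eta>\<^sup>2)) \<le> 3 * (1 + (2 + 2 * E * M * z))" by simp
  moreover have "z\<^sup>2 \<le> 3 * (1 + (\<tau>\<^sup>2 + \<eta>\<^sup>2))"
  proof -
    have "3 * (1 + (\<tau>\<^sup>2 + \<eta>\<^sup>2)) - z\<^sup>2 = (1 - \<tau>)\<^sup>2 + (1 - \<eta>)\<^sup>2 + (\<tau> - \<eta>)\<^sup>2"
      by (simp add: z_def power2_eq_square algebra_simps)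
    then show ?thesis
      using zero_le_power2[of "1 - \<tau>"] zero_le_power2[of "1 - \<eta>"] zero_le_power2[of "\<tau> - \<eta>"] by linarith
  qed
  ultimately have "z\<^sup>2 \<le> 3 * (1 + (2 + 2 * E * M * z))" by (rule order_trans[rotated])
  \<comment> \<open>The value of \<open>Z\<close> comes from here: as \<open>1 \<le> z\<close>, the
    constant \<open>9\<close> is absorbed into \<open>9 * z\<close>, and a factor \<open>z\<close>
    cancels.\<close>
  also have "\<dots> \<le> Z * z" using z by (simp add: Z algebra_simps)
  finally have "z \<le> Z" using z by (simp add: power2_eq_square)
  show "t \<le> Z * \<delta>" using \<open>z \<le> Z\<close> z \<open>\<delta> > 0\<close> by (simp add: t mult.commute mult_left_mono)
  show "h \<le> Z * \<delta> powr p" using h_le \<open>z \<le> Z\<close> by (meson mult_right_mono order_trans powr_ge_zero)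
  have "M * z * \<delta> powr \<gamma> \<le> M * Z * \<delta> powr \<gamma>"
    using \<open>z \<le> Z\<close> \<open>M \<ge> 1\<close> by (intro mult_right_mono mult_left_mono) auto
  with m_le show "m \<le> M * Z * \<delta> powr \<gamma>" by linarith
qed

section \<open>Error inequality and convergence rates\<close>

context hilbert_scale
begin

text \<open>Expanding the penalty of \<open>x = (x - xd) + xd\<close> cancels the penalty of
  \<open>xd\<close> and leaves the cross term, which is shifted by duality and then bounded by
  Cauchy-Schwarz.\<close>

lemma tikhonov_error_inequality:
  fixes F :: "'a \<Rightarrow> 'b::real_inner"
  assumes x: "x \<in> scale_space DL L s" and xd: "xd \<in> scale_space DL L s" "xd \<in> scale_space DL L u"
    and dual: "x - xd \<in> scale_space DL L (2 * s - u)" and "\<alpha> \<ge> 0"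
    and bound: "(norm (F x - yd))\<^sup>2 + \<alpha> * (norm (op_power DL L s x))\<^sup>2
      \<le> 2 * \<delta>\<^sup>2 + \<alpha> * (norm (op_power DL L s xd))\<^sup>2"
  shows "(norm (F x - yd))\<^sup>2 + \<alpha> * (norm (op_power DL L s (x - xd)))\<^sup>2
    \<le> 2 * \<delta>\<^sup>2 + 2 * \<alpha> * (norm (op_power DL L u xd) * norm (op_power DL L (2 * s - u) (x - xd)))"
proof -
  define v w where "v = op_power DL L s (x - xd)" and "w = op_power DL L s xd"
  have "inner v w = inner (op_power DL L (2 * s - u) (x - xd)) (op_power DL L u xd)"
    unfolding v_def w_def
    by (rule inner_op_power_shift[OF scale_space_diff[OF x xd(1)] xd(1) dual xd(2)]) simp
  then have "\<bar>inner v w\<bar> \<le> norm (op_power DL L u xd) * norm (op_power DL L (2 * s - u) (x - xd))"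
    using Cauchy_Schwarz_ineq2[of "op_power DL L (2 * s - u) (x - xd)" "op_power DL L u xd"]
    by (simp add: mult.commute)
  then have "2 * \<alpha> * - inner v w \<le>
      2 * \<alpha> * (norm (op_power DL L u xd) * norm (op_power DL L (2 * s - u) (x - xd)))"
    using \<open>\<alpha> \<ge> 0\<close> by (intro mult_left_mono) auto
  then have "\<alpha> * (norm v)\<^sup>2 \<le> \<alpha> * ((norm v)\<^sup>2 + 2 * inner v w + (norm w)\<^sup>2) - \<alpha> * (norm w)\<^sup>2
      + 2 * \<alpha> * (norm (op_power DL L u xd) * norm (op_power DL L (2 * s - u) (x - xd)))"
    by (simp add: distrib_left)
  moreover have "(norm (op_power DL L s x))\<^sup>2 = (norm v)\<^sup>2 + 2 * inner v w + (norm w)\<^sup>2"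
  proof -
    have "op_power DL L s x = v + w" by (simp add: v_def w_def op_power_diff x xd)
    then show ?thesis
      by (simp only: power2_norm_eq_inner) (simp add: inner_add_left inner_add_right inner_commute)
  qed
  ultimately show ?thesis
    using bound unfolding v_def[symmetric] w_def[symmetric] by simp
qed

end

theorem theorem2p1:
  fixes DL :: "'a::{real_inner,complete_space} set" and L :: "'a \<Rightarrow> 'a"
    and D :: "'a set" and F :: "'a \<Rightarrow> 'b::{real_inner,complete_space}"
    and R :: "real \<Rightarrow> real" and a s \<gamma> :: real
  assumes "hilbert_scale_generator DL L"
    and "a \<ge> 0" and "- a \<le> s" and "0 < \<gamma>" and "\<gamma> \<le> 1"
    and "\<forall>\<rho>\<ge>0. R \<rho> \<ge> 0"
    and "conditional_stability DL L D F R a s \<gamma>"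
  shows "\<exists>C5 C6 :: real \<Rightarrow> real.
    \<forall>(u::real) (xd::'a) (\<delta>::real) (yd::'b) (x::'a).
      s \<le> u \<longrightarrow> u \<le> 2 * s + a \<longrightarrow> xd \<in> D \<inter> scale_space DL L u \<longrightarrow>
      \<delta> > 0 \<longrightarrow> norm (yd - F xd) \<le> \<delta> \<longrightarrow>
      x \<in> approx_minimizers DL L D F s \<delta> (\<delta> powr (2 - 2 * \<gamma> * ((u - s) / (u + a)))) yd \<longrightarrow>
        (\<forall>r. - a \<le> r \<longrightarrow> r \<le> s \<longrightarrow>
           scale_norm DL L r (x - xd)
             \<le> ennreal (C5 (norm (op_power DL L u xd)) * \<delta> powr (\<gamma> * ((u - r) / (u + a))))) \<and>
        norm (F x - yd) \<le> C6 (norm (op_power DL L u xd)) * \<delta>"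
proof -
  interpret hilbert_scale DL L by unfold_locales fact
  obtain c where c: "c > 0" "c \<le> 1" "\<And>\<mu>. \<mu> \<in> eigenvalues DL L \<Longrightarrow> c \<le> \<bar>\<mu>\<bar>"
    using eigenvalues_bounded_below by blast
  \<comment> \<open>Both \<open>s - r\<close> and \<open>u - s\<close> are at most
    \<open>s + a\<close>, so one embedding constant serves all \<open>u\<close> and
    \<open>r\<close>.\<close>
  define \<kappa> where "\<kappa> = c powr - (s + a)"
  have "\<kappa> > 0" using c by (simp add: \<kappa>_def)
  have embed: "norm (op_power DL L r x) \<le> \<kappa> * norm (op_power DL L t x)"
    if "r \<le> t" "t - r \<le> s + a" "x \<in> scale_space DL L t" for r t x
  proof -
    have "c powr (r - t) \<le> \<kappa>" unfolding \<kappa>_def using c that by (intro powr_mono') auto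
    then show ?thesis
      using scale_embedding(2)[OF c(1,3) that(1,3)] by (meson mult_right_mono norm_ge_zero order_trans)
  qed
  \<comment> \<open>The radius \<open>2 + \<kappa> * E\<close> covers both \<open>xd\<close> and the
    minimizer when \<open>\<delta> \<le> 1\<close>. The maxima in \<open>C5\<close> and
    \<open>C6\<close> combine the two cases below; \<open>u\<close> and \<open>\<delta>\<close> do
    not occur in them.\<close>
  define M where "M E = max 1 (R (2 + \<kappa> * E))" for E
  define Z where "Z E = 9 + 6 * E * M E" for E
  define C5 where "C5 E = max (\<kappa> * (2 + 2 * \<kappa> * E)) (M E * Z E)" for E
  define C6 where "C6 E = max (2 + \<kappa> * E) (Z E)" for E
  show ?thesis
  proof (rule exI[of _ C5], rule exI[of _ C6], intro allI impI)
    fix u \<delta> xd x and yd :: 'b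
    assume u: "s \<le> u" "u \<le> 2 * s + a" and xd: "xd \<in> D \<inter> scale_space DL L u" and "\<delta> > 0"
      and noise: "norm (yd - F xd) \<le> \<delta>"
      and x: "x \<in> approx_minimizers DL L D F s \<delta> (\<delta> powr (2 - 2 * \<gamma> * ((u - s) / (u + a)))) yd"
    define p where "p = \<gamma> * ((u - s) / (u + a))"
    define E where "E = norm (op_power DL L u xd)"
    define e where "e = x - xd"
    define t where "t = norm (F x - yd)"
    define N where "N r y = norm (op_power DL L r y)" for r y
    have "E \<ge> 0" "t \<ge> 0" "\<And>r y. N r y \<ge> 0" by (simp_all add: E_def t_def N_def)
    have "p \<ge> 0" using u assms(2-5) by (simp add: p_def)
    have "M E \<ge> 1" by (simp add: M_def)
    have xd_s: "xd \<in> scale_space DL L s" using scale_embedding(1)[OF c(1,3)] u xd by blast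
    have N_xd: "N s xd \<le> \<kappa> * E" using embed[of s u xd] u xd by (simp add: N_def E_def)
    note min = approx_minimizer_bound[OF x _ _ xd_s noise]
    have x_s: "x \<in> D" "x \<in> scale_space DL L s"
      and min_bound: "t\<^sup>2 + \<delta> powr (2 - 2 * p) * (N s x)\<^sup>2 \<le> 2 * \<delta>\<^sup>2 + \<delta> powr (2 - 2 * p) * (N s xd)\<^sup>2"
      using min \<open>\<delta> > 0\<close> xd by (simp_all add: t_def N_def p_def mult.assoc)
    have e_r: "e \<in> scale_space DL L r" if "r \<le> s" for r
      unfolding e_def using scale_embedding(1)[OF c(1,3) that] scale_space_diff x_s xd_s by blast
    \<comment> \<open>Writing \<open>\<delta>\<^sup>2\<close> as a multiple of the regularization
      parameter allows the latter to be cancelled.\<close>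
    have \<delta>2: "\<delta>\<^sup>2 = \<delta> powr (2 - 2 * p) * (\<delta> powr p)\<^sup>2"
      using \<open>\<delta> > 0\<close> by (simp add: power2_eq_square flip: powr_add)
    have "\<delta> powr (2 - 2 * p) * (N s x)\<^sup>2 \<le> 2 * \<delta>\<^sup>2 + \<delta> powr (2 - 2 * p) * (N s xd)\<^sup>2"
      by (rule order_trans[OF _ min_bound]) simp
    then have "\<delta> powr (2 - 2 * p) * (N s x)\<^sup>2 \<le> \<delta> powr (2 - 2 * p) * (2 * (\<delta> powr p)\<^sup>2 + (N s xd)\<^sup>2)"
      unfolding \<delta>2 by (simp add: algebra_simps)
    then have "(N s x)\<^sup>2 \<le> 2 * (\<delta> powr p)\<^sup>2 + (N s xd)\<^sup>2" using \<open>\<delta> > 0\<close> by simp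
    also have "\<dots> \<le> (2 * \<delta> powr p + N s xd)\<^sup>2"
      using \<open>N s xd \<ge> 0\<close> by (simp add: power2_sum)
    finally have N_x: "N s x \<le> 2 * \<delta> powr p + \<kappa> * E"
      using power2_le_imp_le[of "N s x" "2 * \<delta> powr p + N s xd"] N_xd \<open>N s xd \<ge> 0\<close> by simp
    have "(\<forall>r. - a \<le> r \<longrightarrow> r \<le> s \<longrightarrow> N r e \<le> C5 E * \<delta> powr (\<gamma> * ((u - r) / (u + a)))) \<and> t \<le> C6 E * \<delta>"
    proof (cases "\<delta> \<ge> 1 \<or> s = - a")
      case True
      \<comment> \<open>If \<open>s = - a\<close>, then also \<open>u = - a\<close>, and division by
        zero gives \<open>p = 0\<close>.\<close>
      have dp: "\<delta> powr p \<ge> 1" using True \<open>p \<ge> 0\<close> u \<open>\<delta> > 0\<close> by (auto simp: ge_one_powr_ge_zero p_def)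
      have "N s e \<le> N s x + N s xd"
        unfolding N_def e_def op_power_diff[OF x_s(2) xd_s] by (rule norm_triangle_ineq4)
      also have "\<dots> \<le> 2 * \<delta> powr p + 2 * (\<kappa> * E) * 1" using N_x N_xd by simp
      also have "\<dots> \<le> 2 * \<delta> powr p + 2 * (\<kappa> * E) * \<delta> powr p"
        using dp \<open>\<kappa> > 0\<close> \<open>E \<ge> 0\<close> by (intro add_left_mono mult_left_mono) auto
      finally have N_e: "N s e \<le> (2 + 2 * \<kappa> * E) * \<delta> powr p" by (simp add: algebra_simps)
      have "N r e \<le> C5 E * \<delta> powr (\<gamma> * ((u - r) / (u + a)))" if r: "- a \<le> r" "r \<le> s" for r
      proof -
        have "N r e \<le> \<kappa> * N s e" unfolding N_def using r e_r by (intro embed) auto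
        also have "\<dots> \<le> \<kappa> * ((2 + 2 * \<kappa> * E) * \<delta> powr p)"
          using N_e \<open>\<kappa> > 0\<close> by simp
        also have "\<dots> \<le> \<kappa> * ((2 + 2 * \<kappa> * E) * \<delta> powr (\<gamma> * ((u - r) / (u + a))))"
        proof -
          \<comment> \<open>The exponent grows as \<open>r\<close> decreases, which weakens the rate
            for \<open>\<delta> \<ge> 1\<close>; for \<open>s = - a\<close> only
            \<open>r = s\<close> remains.\<close>
          have "\<delta> powr p \<le> \<delta> powr (\<gamma> * ((u - r) / (u + a)))"
          proof (cases "s = - a")
            case False
            then have "p \<le> \<gamma> * ((u - r) / (u + a))" unfolding p_def
              using r u assms(2-5) by (intro mult_left_mono divide_right_mono) auto
            then show ?thesis using True False by (intro powr_mono) auto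
          qed (use r in \<open>simp add: p_def\<close>)
          then show ?thesis using \<open>\<kappa> > 0\<close> \<open>E \<ge> 0\<close> by (intro mult_left_mono) auto
        qed
        also have "\<dots> \<le> C5 E * \<delta> powr (\<gamma> * ((u - r) / (u + a)))"
          unfolding mult.assoc[symmetric] by (intro mult_right_mono) (simp_all add: C5_def)
        finally show ?thesis .
      qed
      moreover have "t \<le> C6 E * \<delta>"
      proof -
        have "\<delta> powr (2 - 2 * p) \<le> \<delta>\<^sup>2"
          using dp \<open>\<delta> > 0\<close> unfolding \<delta>2 by (simp add: one_le_power)
        then have "\<delta> powr (2 - 2 * p) * (N s xd)\<^sup>2 \<le> \<delta>\<^sup>2 * (\<kappa> * E)\<^sup>2"
          using N_xd \<open>N s xd \<ge> 0\<close> by (intro mult_mono power_mono) auto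
        then have "t\<^sup>2 \<le> 2 * \<delta>\<^sup>2 + \<delta>\<^sup>2 * (\<kappa> * E)\<^sup>2"
          using min_bound by (smt (verit) mult_nonneg_nonneg powr_ge_zero zero_le_power2)
        also have "\<dots> \<le> ((2 + \<kappa> * E) * \<delta>)\<^sup>2"
          using \<open>\<kappa> > 0\<close> \<open>E \<ge> 0\<close> \<open>\<delta> > 0\<close> by (simp add: power2_eq_square algebra_simps)
        finally have "t \<le> (2 + \<kappa> * E) * \<delta>"
          by (rule power2_le_imp_le) (use \<open>\<kappa> > 0\<close> \<open>E \<ge> 0\<close> \<open>\<delta> > 0\<close> in simp)
        also have "\<dots> \<le> C6 E * \<delta>" using \<open>\<delta> > 0\<close> by (intro mult_right_mono) (simp_all add: C6_def)
        finally show ?thesis .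
      qed
      ultimately show ?thesis by blast
    next
      case False
      then have "\<delta> < 1" "s + a > 0" "u + a > 0" using assms(3) u by auto
      define \<rho> where "\<rho> = 2 + \<kappa> * E"
      have "\<rho> \<ge> 0" using \<open>\<kappa> > 0\<close> \<open>E \<ge> 0\<close> by (simp add: \<rho>_def)
      \<comment> \<open>This replaces \<open>2 * \<delta> powr p\<close> by \<open>2\<close> in the
        bound for \<open>x\<close>, so the radius depends on \<open>E\<close> alone.\<close>
      have "\<delta> powr p \<le> 1" using \<open>\<delta> < 1\<close> \<open>\<delta> > 0\<close> \<open>p \<ge> 0\<close> by (simp add: powr_le1)
      then have "x \<in> source_ball DL L D s \<rho>" "xd \<in> source_ball DL L D s \<rho>"
        using N_x N_xd x_s xd_s xd \<open>\<rho> \<ge> 0\<close>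
        by (auto simp: source_ball_def scale_norm_def \<rho>_def N_def)
      then have "scale_norm DL L (- a) e \<le> ennreal (R \<rho> * norm (F x - F xd) powr \<gamma>)"
        using assms(7) \<open>\<rho> \<ge> 0\<close> unfolding conditional_stability_def e_def by blast
      then have "N (- a) e \<le> R \<rho> * norm (F x - F xd) powr \<gamma>"
        using e_r[of "- a"] assms(3,6) \<open>\<rho> \<ge> 0\<close> by (simp add: scale_norm_def N_def)
      also have "\<dots> \<le> M E * (t + \<delta>) powr \<gamma>"
      proof -
        have "norm (F x - F xd) \<le> t + \<delta>"
          using norm_triangle_ineq[of "F x - yd" "yd - F xd"] noise by (simp add: t_def)
        then show ?thesis
          using assms(4) by (intro mult_mono powr_mono2) (auto simp: M_def \<rho>_def)
      qed
      finally have stab: "N (- a) e \<le> M E * (t + \<delta>) powr \<gamma>" .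
      have interp: "N r e \<le> N s e powr (1 - \<theta>) * N (- a) e powr \<theta>"
        if "0 \<le> \<theta>" "\<theta> \<le> 1" "r = s - \<theta> * (s + a)" for r \<theta>
        unfolding N_def
      proof (rule interpolation)
        show "r = (1 - \<theta>) * s + \<theta> * - a" using that by (simp add: algebra_simps)
        show "e \<in> scale_space DL L r" using that \<open>s + a > 0\<close> by (intro e_r) simp
      qed (use that e_r assms(3) in auto)
      \<comment> \<open>The position of the dual index \<open>2 * s - u\<close> between
        \<open>s\<close> and \<open>- a\<close>; the condition \<open>u \<le> 2 * s + a\<close> says
        exactly that \<open>\<theta> \<le> 1\<close>.\<close>
      define \<theta> where "\<theta> = (u - s) / (s + a)"
      have \<theta>: "0 \<le> \<theta>" "\<theta> \<le> 1" "2 * s - u = s - \<theta> * (s + a)"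
        using u \<open>s + a > 0\<close> by (simp_all add: \<theta>_def)
      have "1 + \<theta> = (u + a) / (s + a)" using \<open>s + a > 0\<close> by (simp add: \<theta>_def field_simps)
      then have p\<theta>: "p * (1 + \<theta>) = \<gamma> * \<theta>"
        using \<open>u + a > 0\<close> by (simp add: p_def \<theta>_def)
      have error: "t\<^sup>2 + \<delta> powr (2 - 2 * p) * (N s e)\<^sup>2
          \<le> 2 * \<delta>\<^sup>2 + 2 * \<delta> powr (2 - 2 * p) * (E * N (2 * s - u) e)"
        unfolding t_def N_def E_def e_def
        by (rule tikhonov_error_inequality)
          (use x_s xd_s xd e_r[of "2 * s - u"] u min_bound in \<open>auto simp: e_def t_def N_def\<close>)
      note bounds = rescaled_error_bound[OF \<open>\<delta> > 0\<close> assms(4,5) \<theta>(1,2) p\<theta> \<open>E \<ge> 0\<close> \<open>M E \<ge> 1\<close> \<open>t \<ge> 0\<close>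
          \<open>N s e \<ge> 0\<close> \<open>N (- a) e \<ge> 0\<close> stab interp[OF \<theta>] error Z_def]
      have "Z E \<ge> 1" using \<open>E \<ge> 0\<close> \<open>M E \<ge> 1\<close> by (simp add: Z_def add_increasing2)
      \<comment> \<open>With the common constant \<open>M E * Z E\<close> at both endpoint indices,
        its powers recombine under interpolation.\<close>
      then have "M E * Z E \<ge> 1 * Z E" using \<open>M E \<ge> 1\<close> by (intro mult_right_mono) auto
      have "N r e \<le> C5 E * \<delta> powr (\<gamma> * ((u - r) / (u + a)))" if r: "- a \<le> r" "r \<le> s" for r
      proof -
        define \<eta> where "\<eta> = (s - r) / (s + a)"
        have \<eta>: "0 \<le> \<eta>" "\<eta> \<le> 1" "r = s - \<eta> * (s + a)"
          using r \<open>s + a > 0\<close> by (simp_all add: \<eta>_def)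
        have "N s e \<le> M E * Z E * \<delta> powr p"
          by (rule order_trans[OF bounds(2)]) (use \<open>M E * Z E \<ge> 1 * Z E\<close> in \<open>simp add: mult_right_mono\<close>)
        then have "N r e \<le> (M E * Z E * \<delta> powr p) powr (1 - \<eta>) * (M E * Z E * \<delta> powr \<gamma>) powr \<eta>"
          using bounds(3) \<eta> \<open>N s e \<ge> 0\<close> \<open>N (- a) e \<ge> 0\<close>
          by (intro order_trans[OF interp[OF \<eta>]] mult_mono powr_mono2) auto
        also have "\<dots> = ((M E * Z E) powr (1 - \<eta>) * (M E * Z E) powr \<eta>) * (\<delta> powr (p * (1 - \<eta>)) * \<delta> powr (\<gamma> * \<eta>))"
          by (simp add: powr_mult powr_powr)
        also have "(M E * Z E) powr (1 - \<eta>) * (M E * Z E) powr \<eta> = M E * Z E"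
          using \<open>M E * Z E \<ge> 1 * Z E\<close> \<open>Z E \<ge> 1\<close> by (simp flip: powr_add)
        also have "\<delta> powr (p * (1 - \<eta>)) * \<delta> powr (\<gamma> * \<eta>) = \<delta> powr (\<gamma> * ((u - r) / (u + a)))"
        proof -
          \<comment> \<open>The exponent of the rate is affine in \<open>r\<close>, with value
            \<open>p\<close> at \<open>s\<close> and \<open>\<gamma>\<close> at
            \<open>- a\<close>.\<close>
          have "p * (1 - \<eta>) + \<gamma> * \<eta> = \<gamma> * ((u - r) / (u + a))"
            using \<open>s + a > 0\<close> \<open>u + a > 0\<close> unfolding p_def \<eta>_def
            by (simp add: divide_simps) (simp add: algebra_simps)
          then show ?thesis by (simp flip: powr_add)
        qed
        also have "M E * Z E * \<delta> powr (\<gamma> * ((u - r) / (u + a))) \<le> C5 E * \<delta> powr (\<gamma> * ((u - r) / (u + a)))"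
          by (intro mult_right_mono) (simp_all add: C5_def)
        finally show ?thesis .
      qed
      moreover have "t \<le> C6 E * \<delta>"
        by (rule order_trans[OF bounds(1)]) (use \<open>\<delta> > 0\<close> in \<open>simp add: C6_def\<close>)
      ultimately show ?thesis by blast
    qed
    moreover have "scale_norm DL L r (x - xd) = ennreal (N r e)" if "r \<le> s" for r
      using e_r[OF that] by (simp add: scale_norm_def N_def e_def)
    ultimately show "(\<forall>r. - a \<le> r \<longrightarrow> r \<le> s \<longrightarrow>
           scale_norm DL L r (x - xd)
             \<le> ennreal (C5 (norm (op_power DL L u xd)) * \<delta> powr (\<gamma> * ((u - r) / (u + a))))) \<and>
        norm (F x - yd) \<le> C6 (norm (op_power DL L u xd)) * \<delta>"
      by (simp add: ennreal_leI E_def t_def)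
  qed
qed

end
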